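(* Let $(E;\xi,\eta)$ be a triangular elliptic curve and $(\Lambda,\phi)$ the associated parabolic $\mathbb Q$-lattice. Its image, under the right action of $w=\begin{pmatrix} u&v\\0&1\end{pmatrix}\in P(\hat{\mathbb Z})$, is the triangular elliptic curve $(E;\xi',\eta')$ where $\xi'=\xi\circ u$ and $\eta'=\eta+\xi\circ v$.
   Context: For an elliptic curve $E=\mathbb C/\Lambda$, $E_{\rm tor}=\mathbb Q\Lambda/\Lambda$, $TE=\mathrm{Hom}(\mathbb Q/\mathbb Z,E_{\rm tor})$, and a character $\chi\in\mathrm{Hom}(E,\mathbb R/\mathbb Z)$ (continuous homomorphism) gives $T(\chi):TE\to\mathrm{Hom}(\mathbb Q/\mathbb Z,\mathbb Q/\mathbb Z)=\hat{\mathbb Z}$. For $\xi\in TE$, $\xi^\perp=\{\chi: T(\chi)(\xi)=0\}$. A triangular elliptic curve is $E$ with a pair $(\xi,\eta)$ of elements of $TE$ such that $\xi\ne0$ and $\{T(\chi)(\eta):\chi\in\xi^\perp\}=\mathbb Z\subset\hat{\mathbb Z}$. Elements $u,v\in\hat{\mathbb Z}$ are viewed as endomorphisms of $\mathbb Q/\mathbb Z$. $P(\hat{\mathbb Z})=\left\{\begin{pmatrix} u&v\\0&1\end{pmatrix}:u\in\hat{\mathbb Z}^\times,v\in\hat{\mathbb Z}\right\}$, $\overline{P(\hat{\mathbb Z})}$ is the set of such matrices with $u\in\hat{\mathbb Z}$ arbitrary, $P^+(\mathbb R)=\left\{\begin{pmatrix} a&b\\0&1\end{pmatrix}:a>0,b\in\mathbb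 R\right\}$, $P^+(\mathbb Z)=\left\{\begin{pmatrix}1&n\\0&1\end{pmatrix}:n\in\mathbb Z\right\}$. With $e_1=1$, $e_2=-i$ as $\mathbb R$-basis of $\mathbb C$ (matrices acting in this basis) and $\Lambda_0=\mathbb Ze_1+\mathbb Ze_2$, a pair $(\rho,\alpha)\in\overline{P(\hat{\mathbb Z})}\times P^+(\mathbb R)$, $\rho=\begin{pmatrix} a&b\\0&1\end{pmatrix}$, defines the parabolic $\mathbb Q$-lattice $(\Lambda,\phi)=(\alpha^{-1}\Lambda_0,\alpha^{-1}\circ\rho)$, where $\rho(x,y)=(ax+by)e_1+ye_2$ for $(x,y)\in(\mathbb Q/\mathbb Z)^2$. The space of parabolic $\mathbb Q$-lattices is $\Pi=P^+(\mathbb Z)\backslash(\overline{P(\hat{\mathbb Z})}\times P^+(\mathbb R))$, on which $w\in P(\hat{\mathbb Z})$ acts on the right by $(\rho,\alpha)\mapsto(\rho w,\alpha)$. A parabolic $\mathbb Q$-lattice $(\Lambda,\phi)$ gives the triple $(\mathbb C/\Lambda;\xi,\eta)$ with $\xi(x)=\phi(x,0)$, $\eta(y)=\phi(0,y)$; each triangular elliptic curve arises (up to isomorphism) from a unique parabolic $\mathbb Q$-lattice, called the associated one. *)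

theory Defs
  imports "HOL-Analysis.Analysis" "HOL-Algebra.Coset"
begin

section \<open>The groups \<open>\<rat>/\<int>\<close> and \<open>\<real>/\<int>\<close>\<close>

quotient_type rat_mod_int = rat / "\<lambda>x y. x - y \<in> \<int>"
  morphisms rep_rat_mod_int rat_class
proof (rule equivpI)
  show "reflp (\<lambda>x y :: rat. x - y \<in> \<int>)" by (simp add: reflp_def)
  show "symp (\<lambda>x y :: rat. x - y \<in> \<int>)"
  proof (rule sympI)
    fix x y :: rat assume "x - y \<in> \<int>"
    then have "- (x - y) \<in> \<int>" by (rule Ints_minus)
    then show "y - x \<in> \<int>" by simp
  qed
  show "transp (\<lambda>x y :: rat. x - y \<in> \<int>)"
  proof (rule transpI)
    fix x y z :: rat assume "x - y \<in> \<int>" "y - z \<in> \<int>"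
    then have "(x - y) + (y - z) \<in> \<int>" by (rule Ints_add)
    then show "x - z \<in> \<int>" by simp
  qed
qed

instantiation rat_mod_int :: ab_group_add
begin
lift_definition zero_rat_mod_int :: rat_mod_int is 0 .
lift_definition plus_rat_mod_int :: "rat_mod_int \<Rightarrow> rat_mod_int \<Rightarrow> rat_mod_int" is "(+)"
proof -
  fix a b c d :: rat assume "a - b \<in> \<int>" "c - d \<in> \<int>"
  then have "(a - b) + (c - d) \<in> \<int>" by (rule Ints_add)
  then show "a + c - (b + d) \<in> \<int>" by (simp add: algebra_simps)
qed
lift_definition minus_rat_mod_int :: "rat_mod_int \<Rightarrow> rat_mod_int \<Rightarrow> rat_mod_int" is "(-)"
proof -
  fix a b c d :: rat assume "a - b \<in> \<int>" "c - d \<in> \<int>"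
  then have "(a - b) - (c - d) \<in> \<int>" by (rule Ints_diff)
  then show "a - c - (b - d) \<in> \<int>" by (simp add: algebra_simps)
qed
lift_definition uminus_rat_mod_int :: "rat_mod_int \<Rightarrow> rat_mod_int" is uminus
proof -
  fix a b :: rat assume "a - b \<in> \<int>"
  then have "- (a - b) \<in> \<int>" by (rule Ints_minus)
  then show "- a - - b \<in> \<int>" by simp
qed
instance
proof
  fix a b c :: rat_mod_int
  show "a + b + c = a + (b + c)" by transfer (simp add: add.assoc)
  show "a + b = b + a" by transfer (simp add: add.commute)
  show "0 + a = a" by transfer simp
  show "- a + a = 0" by transfer simp
  show "a - b = a + - b" by transfer simp
qed
end

quotient_type real_mod_int = real / "\<lambda>x y. x - y \<in> \<int>"
  morphisms rep_real_mod_int real_class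
proof (rule equivpI)
  show "reflp (\<lambda>x y :: real. x - y \<in> \<int>)" by (simp add: reflp_def)
  show "symp (\<lambda>x y :: real. x - y \<in> \<int>)"
  proof (rule sympI)
    fix x y :: real assume "x - y \<in> \<int>"
    then have "- (x - y) \<in> \<int>" by (rule Ints_minus)
    then show "y - x \<in> \<int>" by simp
  qed
  show "transp (\<lambda>x y :: real. x - y \<in> \<int>)"
  proof (rule transpI)
    fix x y z :: real assume "x - y \<in> \<int>" "y - z \<in> \<int>"
    then have "(x - y) + (y - z) \<in> \<int>" by (rule Ints_add)
    then show "x - z \<in> \<int>" by simp
  qed
qed

instantiation real_mod_int :: ab_group_add
begin
lift_definition zero_real_mod_int :: real_mod_int is 0 .
lift_definition plus_real_mod_int :: "real_mod_int \<Rightarrow> real_mod_int \<Rightarrow> real_mod_int" is "(+)"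
proof -
  fix a b c d :: real assume "a - b \<in> \<int>" "c - d \<in> \<int>"
  then have "(a - b) + (c - d) \<in> \<int>" by (rule Ints_add)
  then show "a + c - (b + d) \<in> \<int>" by (simp add: algebra_simps)
qed
lift_definition minus_real_mod_int :: "real_mod_int \<Rightarrow> real_mod_int \<Rightarrow> real_mod_int" is "(-)"
proof -
  fix a b c d :: real assume "a - b \<in> \<int>" "c - d \<in> \<int>"
  then have "(a - b) - (c - d) \<in> \<int>" by (rule Ints_diff)
  then show "a - c - (b - d) \<in> \<int>" by (simp add: algebra_simps)
qed
lift_definition uminus_real_mod_int :: "real_mod_int \<Rightarrow> real_mod_int" is uminus
proof -
  fix a b :: real assume "a - b \<in> \<int>"
  then have "- (a - b) \<in> \<int>" by (rule Ints_minus)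
  then show "- a - - b \<in> \<int>" by simp
qed
instance
proof
  fix a b c :: real_mod_int
  show "a + b + c = a + (b + c)" by transfer (simp add: add.assoc)
  show "a + b = b + a" by transfer (simp add: add.commute)
  show "0 + a = a" by transfer simp
  show "- a + a = 0" by transfer simp
  show "a - b = a + - b" by transfer simp
qed
end

text \<open>\<open>\<real>/\<int>\<close> carries the quotient topology.\<close>

instantiation real_mod_int :: topological_space
begin
definition open_real_mod_int :: "real_mod_int set \<Rightarrow> bool"
  where "open_real_mod_int U \<longleftrightarrow> open (real_class -` U)"
instance
  by standard (auto simp: open_real_mod_int_def vimage_Union)
end

lift_definition real_of_rat_mod_int :: "rat_mod_int \<Rightarrow> real_mod_int" is "of_rat"
proof -
  fix a b :: rat assume "a - b \<in> \<int>"
  then obtain k where "a - b = of_int k" by (rule Ints_cases)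
  then have "of_rat a - of_rat b = (of_int k :: real)" by (metis of_rat_diff of_rat_of_int_eq)
  then show "of_rat a - of_rat b \<in> (\<int> :: real set)" by simp
qed


section \<open>The ring of endomorphisms of \<open>\<rat>/\<int>\<close>\<close>

typedef zhat = "{f :: rat_mod_int \<Rightarrow> rat_mod_int. \<forall>x y. f (x + y) = f x + f y}"
  morphisms zhat_apply Abs_zhat
  by (rule exI[of _ "\<lambda>_. 0"]) simp

setup_lifting type_definition_zhat

lemma zhat_apply_add: "zhat_apply f (x + y) = zhat_apply f x + zhat_apply f y"
  using zhat_apply[of f] by blast

lemma additive_rat_class_mult_int:
  assumes f: "\<And>x y. f (x + y) = f x + f y" and r: "f (rat_class r) = rat_class s"
  shows "f (rat_class (of_int m * r)) = rat_class (of_int m * s)"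
proof -
  have split: "rat_class (of_int (i + 1) * t) = rat_class (of_int i * t) + rat_class t" for i :: int and t
    by (simp only: plus_rat_mod_int.abs_eq of_int_add of_int_1 distrib_right mult_1_left)
  have up: "f (rat_class (of_int (i + 1) * r)) = f (rat_class (of_int i * r)) + rat_class s" for i :: int
    by (simp only: split f r)
  show ?thesis
  proof (induction m rule: int_induct[where k = 0])
    case base
    have "f (0 + 0) = f 0 + f 0" by (rule f)
    then have "f 0 = 0" by simp
    then show ?case by (simp add: zero_rat_mod_int_def)
  next
    case (step1 i)
    show ?case by (rule trans[OF up[of i, unfolded step1.IH] split[of i s, symmetric]])
  next
    case (step2 i)
    have "f (rat_class (of_int (i - 1) * r)) + rat_class s = rat_class (of_int (i - 1) * s) + rat_class s"
      using step2.IH up[of "i - 1"] split[of "i - 1" s] by simp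
    then show ?case by (rule add_right_imp_eq)
  qed
qed

lemma rat_class_eq_0_iff: "rat_class q = 0 \<longleftrightarrow> q \<in> \<int>"
  unfolding zero_rat_mod_int_def by (simp add: rat_mod_int.abs_eq_iff)

lemma rat_class_surj: obtains q where "x = rat_class q"
  by (metis Quotient_rat_mod_int Quotient_abs_rep)

lemma additive_commute:
  fixes f g :: "rat_mod_int \<Rightarrow> rat_mod_int"
  assumes f: "\<And>x y. f (x + y) = f x + f y" and g: "\<And>x y. g (x + y) = g x + g y"
  shows "f (g x) = g (f x)"
proof -
  obtain q where q: "x = rat_class q" by (rule rat_class_surj)
  obtain a b where ab: "quotient_of q = (a, b)" by fastforce
  define t :: rat where "t = 1 / of_int b"
  have b: "b > 0" using quotient_of_denom_pos[OF ab] .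
  have bt: "of_int b * t = 1" using b by (simp add: t_def)
  have qab: "q = of_int a * t" using quotient_of_div[OF ab] by (simp add: t_def)
  have gen: "\<exists>k. h (rat_class t) = rat_class (of_int k * t)"
    if h: "\<And>x y. h (x + y) = h x + h y" for h :: "rat_mod_int \<Rightarrow> rat_mod_int"
  proof -
    obtain r where r: "h (rat_class t) = rat_class r" by (rule rat_class_surj)
    have "h (0 + 0) = h 0 + h 0" by (rule h)
    then have "h 0 = 0" by simp
    moreover have "h (rat_class (of_int b * t)) = rat_class (of_int b * r)"
      by (rule additive_rat_class_mult_int[OF h r])
    moreover have "rat_class 1 = 0" by (simp add: rat_class_eq_0_iff)
    ultimately have "rat_class (of_int b * r) = 0" by (simp add: bt)
    then obtain k where k: "of_int b * r = of_int k"
      by (auto simp: rat_class_eq_0_iff elim: Ints_cases)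
    have "r = (of_int b * t) * r" by (simp add: bt)
    also have "\<dots> = (of_int b * r) * t" by (simp only: mult_ac)
    also have "\<dots> = of_int k * t" by (simp only: k)
    finally show ?thesis using r by blast
  qed
  obtain k where k: "f (rat_class t) = rat_class (of_int k * t)" using gen[OF f] by blast
  obtain l where l: "g (rat_class t) = rat_class (of_int l * t)" using gen[OF g] by blast
  have F: "f (rat_class (of_int m * t)) = rat_class (of_int (m * k) * t)" for m
    using additive_rat_class_mult_int[OF f k, of m] by (simp add: mult.assoc)
  have G: "g (rat_class (of_int m * t)) = rat_class (of_int (m * l) * t)" for m
    using additive_rat_class_mult_int[OF g l, of m] by (simp add: mult.assoc)
  have "a * l * k = a * k * l" by simp
  then show ?thesis
    unfolding q qab F G by (simp only:)
qed

instantiation zhat :: comm_ring_1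
begin
lift_definition zero_zhat :: zhat is "\<lambda>_. 0" by simp
lift_definition one_zhat :: zhat is "\<lambda>x. x" by simp
lift_definition plus_zhat :: "zhat \<Rightarrow> zhat \<Rightarrow> zhat" is "\<lambda>f g x. f x + g x"
  by (simp add: algebra_simps)
lift_definition minus_zhat :: "zhat \<Rightarrow> zhat \<Rightarrow> zhat" is "\<lambda>f g x. f x - g x"
  by (simp add: algebra_simps)
lift_definition uminus_zhat :: "zhat \<Rightarrow> zhat" is "\<lambda>f x. - f x"
  by (simp add: algebra_simps)
lift_definition times_zhat :: "zhat \<Rightarrow> zhat \<Rightarrow> zhat" is "\<lambda>f g x. f (g x)"
  by simp
instance
proof
  fix a b c :: zhat
  show "a + b + c = a + (b + c)" by transfer (simp add: add.assoc)
  show "a + b = b + a" by transfer (simp add: add.commute)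
  show "0 + a = a" by transfer simp
  show "- a + a = 0" by transfer simp
  show "a - b = a + - b" by transfer simp
  show "a * b * c = a * (b * c)" by transfer simp
  show "a * b = b * a" by transfer (rule ext, rule additive_commute; simp)
  show "1 * a = a" by transfer simp
  show "(a + b) * c = a * c + b * c" by transfer simp
  show "(0 :: zhat) \<noteq> 1"
  proof transfer
    have "(1 / 2 :: rat) \<notin> \<int>"
    proof
      assume "(1 / 2 :: rat) \<in> \<int>"
      then obtain k :: int where "(1 / 2 :: rat) = of_int k" by (rule Ints_cases)
      then have "(of_int 1 :: rat) = of_int (2 * k)" by simp
      then have "1 = 2 * k" by (simp only: of_int_eq_iff)
      then show False by presburger
    qed
    then have "rat_class (1 / 2) \<noteq> 0" by (simp add: rat_class_eq_0_iff)
    then show "(\<lambda>_. 0) \<noteq> (\<lambda>x :: rat_mod_int. x)" by (auto dest: fun_cong)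
  qed
qed
end


section \<open>Elliptic curves, Tate modules and characters\<close>

definition additive_group :: "'a::ab_group_add monoid"
  where "additive_group = \<lparr>carrier = UNIV, monoid.mult = (+), one = 0\<rparr>"

definition is_lattice :: "complex set \<Rightarrow> bool"
  where "is_lattice \<Lambda> \<longleftrightarrow> (\<exists>w1 w2. w1 \<noteq> w2 \<and> independent {w1, w2} \<and>
           \<Lambda> = {of_int m * w1 + of_int n * w2 | m n. True})"

definition elliptic_curve :: "complex set \<Rightarrow> complex set monoid"
  where "elliptic_curve \<Lambda> = additive_group Mod \<Lambda>"

definition proj_curve :: "complex set \<Rightarrow> complex \<Rightarrow> complex set"
  where "proj_curve \<Lambda> z = \<Lambda> #>\<^bsub>additive_group\<^esub> z"

definition curve_topology :: "complex set \<Rightarrow> complex set topology"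
  where "curve_topology \<Lambda> =
           topology (\<lambda>U. U \<subseteq> carrier (elliptic_curve \<Lambda>) \<and> open (proj_curve \<Lambda> -` U))"

lemma openin_curve_topology:
  "openin (curve_topology \<Lambda>) U \<longleftrightarrow>
     U \<subseteq> carrier (elliptic_curve \<Lambda>) \<and> open (proj_curve \<Lambda> -` U)"
proof -
  have "istopology (\<lambda>U. U \<subseteq> carrier (elliptic_curve \<Lambda>) \<and> open (proj_curve \<Lambda> -` U))"
    unfolding istopology_def by (auto simp: vimage_Union)
  then show ?thesis by (simp add: curve_topology_def)
qed

text \<open>By common denominators, this is the \<open>\<rat>\<close>-span of a lattice \<open>\<Lambda>\<close>.\<close>

definition rational_multiples :: "complex set \<Rightarrow> complex set"
  where "rational_multiples \<Lambda> = {of_rat q * l | q l. l \<in> \<Lambda>}"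

definition torsion_group :: "complex set \<Rightarrow> complex set monoid"
  where "torsion_group \<Lambda> = (additive_group\<lparr>carrier := rational_multiples \<Lambda>\<rparr>) Mod \<Lambda>"

definition tate_module :: "complex set \<Rightarrow> (rat_mod_int \<Rightarrow> complex set) set"
  where "tate_module \<Lambda> = hom additive_group (torsion_group \<Lambda>)"

definition characters :: "complex set \<Rightarrow> (complex set \<Rightarrow> real_mod_int) set"
  where "characters \<Lambda> = {\<psi> \<in> hom (elliptic_curve \<Lambda>) additive_group.
           continuous_map (curve_topology \<Lambda>) euclidean \<psi> \<and>
           \<psi> \<in> extensional (carrier (elliptic_curve \<Lambda>))}"

text \<open>
  A character maps torsion points into \<open>\<rat>/\<int> \<subseteq> \<real>/\<int>\<close>, so that composing it with an element of
  the Tate module gives an endomorphism of \<open>\<rat>/\<int>\<close>.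
\<close>

definition tate_map :: "(complex set \<Rightarrow> real_mod_int) \<Rightarrow> (rat_mod_int \<Rightarrow> complex set) \<Rightarrow> zhat"
  where "tate_map \<psi> \<xi> = (THE f. \<forall>x. real_of_rat_mod_int (zhat_apply f x) = \<psi> (\<xi> x))"

definition orth :: "complex set \<Rightarrow> (rat_mod_int \<Rightarrow> complex set) \<Rightarrow> (complex set \<Rightarrow> real_mod_int) set"
  where "orth \<Lambda> \<xi> = {\<psi> \<in> characters \<Lambda>. tate_map \<psi> \<xi> = 0}"

definition triangular ::
    "complex set \<Rightarrow> (rat_mod_int \<Rightarrow> complex set) \<Rightarrow> (rat_mod_int \<Rightarrow> complex set) \<Rightarrow> bool"
  where "triangular \<Lambda> \<xi> \<eta> \<longleftrightarrow>
           is_lattice \<Lambda> \<and> \<xi> \<in> tate_module \<Lambda> \<and> \<eta> \<in> tate_module \<Lambda> \<and>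
           \<xi> \<noteq> (\<lambda>_. \<one>\<^bsub>torsion_group \<Lambda>\<^esub>) \<and>
           {tate_map \<psi> \<eta> | \<psi>. \<psi> \<in> orth \<Lambda> \<xi>} = \<int>"

text \<open>
  Isomorphisms of complex Lie groups. Since the projections are local charts, a map between the
  quotients is holomorphic iff it lifts locally to a holomorphic function.
\<close>

definition curve_iso :: "complex set \<Rightarrow> complex set \<Rightarrow> (complex set \<Rightarrow> complex set) \<Rightarrow> bool"
  where "curve_iso \<Lambda> \<Lambda>' f \<longleftrightarrow>
           f \<in> iso (elliptic_curve \<Lambda>) (elliptic_curve \<Lambda>') \<and>
           (\<forall>z. \<exists>U g. open U \<and> z \<in> U \<and> g holomorphic_on U \<and>
                  (\<forall>y\<in>U. f (proj_curve \<Lambda> y) = proj_curve \<Lambda>' (g y)))"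

definition triple_iso ::
    "complex set \<times> (rat_mod_int \<Rightarrow> complex set) \<times> (rat_mod_int \<Rightarrow> complex set) \<Rightarrow>
     complex set \<times> (rat_mod_int \<Rightarrow> complex set) \<times> (rat_mod_int \<Rightarrow> complex set) \<Rightarrow> bool"
  where "triple_iso = (\<lambda>(\<Lambda>, \<xi>, \<eta>) (\<Lambda>', \<xi>', \<eta>').
           \<exists>f. curve_iso \<Lambda> \<Lambda>' f \<and> (\<forall>x. f (\<xi> x) = \<xi>' x) \<and> (\<forall>y. f (\<eta> y) = \<eta>' y))"


section \<open>Parabolic \<open>\<rat>\<close>-lattices\<close>

definition par_matrix :: "'a \<Rightarrow> 'a \<Rightarrow> 'a::{zero,one}^2^2"
  where "par_matrix u v = vector [vector [u, v], vector [0, 1]]"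

type_synonym parabolic_pair = "(zhat^2^2) \<times> (real^2^2)"

definition P_zhat :: "(zhat^2^2) set"
  where "P_zhat = {par_matrix u v | u v. u dvd 1}"

definition P_zhat_closure :: "(zhat^2^2) set"
  where "P_zhat_closure = {par_matrix u v | u v. True}"

definition P_plus_real :: "(real^2^2) set"
  where "P_plus_real = {par_matrix a b | a b. a > 0}"

definition P_plus_int :: "(int^2^2) set"
  where "P_plus_int = {par_matrix 1 n | n. True}"

definition parabolic_rel :: "(parabolic_pair \<times> parabolic_pair) set"
  where "parabolic_rel = {((\<rho>, \<alpha>), (\<rho>', \<alpha>')).
           \<rho> \<in> P_zhat_closure \<and> \<alpha> \<in> P_plus_real \<and>
           (\<exists>\<gamma>\<in>P_plus_int. \<rho>' = map_matrix of_int \<gamma> ** \<rho> \<and> \<alpha>' = map_matrix of_int \<gamma> ** \<alpha>)}"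

definition parabolic_space :: "parabolic_pair set set"
  where "parabolic_space = (P_zhat_closure \<times> P_plus_real) // parabolic_rel"

definition parabolic_act :: "parabolic_pair set \<Rightarrow> zhat^2^2 \<Rightarrow> parabolic_pair set"
  where "parabolic_act X w = (\<lambda>(\<rho>, \<alpha>). (\<rho> ** w, \<alpha>)) ` X"

lemma par_matrix_eq_iff: "par_matrix u v = par_matrix u' v' \<longleftrightarrow> u = u' \<and> v = v'"
  by (auto simp: par_matrix_def vec_eq_iff forall_2)

lemma par_matrix_mult:
  fixes u v u' v' :: "'a::semiring_1"
  shows "par_matrix u v ** par_matrix u' v' = par_matrix (u * u') (u * v' + v)"
  by (simp add: par_matrix_def matrix_matrix_mult_def vec_eq_iff forall_2 sum_2)

lemma map_matrix_par_matrix: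
  "map_matrix of_int (par_matrix 1 n) = (par_matrix 1 (of_int n) :: 'a::ring_1^2^2)"
  by (simp add: par_matrix_def vec_eq_iff forall_2)

lemma parabolic_rel_alt:
  "((\<rho>, \<alpha>), (\<rho>', \<alpha>')) \<in> parabolic_rel \<longleftrightarrow>
     (\<exists>a b c d n. 0 < c \<and> \<rho> = par_matrix a b \<and> \<alpha> = par_matrix c d \<and>
        \<rho>' = par_matrix a (b + of_int n) \<and> \<alpha>' = par_matrix c (d + of_int n))"
  (is "_ \<longleftrightarrow> ?R")
proof
  assume "((\<rho>, \<alpha>), (\<rho>', \<alpha>')) \<in> parabolic_rel"
  then obtain a b c d n where *: "\<rho> = par_matrix a b" "\<alpha> = par_matrix c d" "c > 0"
    and "\<rho>' = map_matrix of_int (par_matrix 1 n) ** \<rho>" "\<alpha>' = map_matrix of_int (par_matrix 1 n) ** \<alpha>"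
    unfolding parabolic_rel_def P_zhat_closure_def P_plus_real_def P_plus_int_def by blast
  then have "\<rho>' = par_matrix a (b + of_int n)" "\<alpha>' = par_matrix c (d + of_int n)"
    unfolding * map_matrix_par_matrix par_matrix_mult by simp_all
  with * show "?R" by blast
next
  assume ?R
  then obtain a b c d n where *: "0 < c" "\<rho> = par_matrix a b" "\<alpha> = par_matrix c d"
      "\<rho>' = par_matrix a (b + of_int n)" "\<alpha>' = par_matrix c (d + of_int n)"
    by blast
  have "\<rho>' = map_matrix of_int (par_matrix 1 n) ** \<rho>" "\<alpha>' = map_matrix of_int (par_matrix 1 n) ** \<alpha>"
    unfolding * map_matrix_par_matrix par_matrix_mult by simp_all
  moreover have "\<rho> \<in> P_zhat_closure" "\<alpha> \<in> P_plus_real" "par_matrix 1 n \<in> P_plus_int"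
    using * unfolding P_zhat_closure_def P_plus_real_def P_plus_int_def by blast+
  ultimately show "((\<rho>, \<alpha>), (\<rho>', \<alpha>')) \<in> parabolic_rel"
    unfolding parabolic_rel_def by blast
qed

lemma equiv_parabolic_rel: "equiv (P_zhat_closure \<times> P_plus_real) parabolic_rel"
proof (rule equivI)
  show "parabolic_rel \<subseteq> (P_zhat_closure \<times> P_plus_real) \<times> (P_zhat_closure \<times> P_plus_real)"
    by (auto simp: parabolic_rel_alt P_zhat_closure_def P_plus_real_def par_matrix_eq_iff)
  show "refl_on (P_zhat_closure \<times> P_plus_real) parabolic_rel"
  proof (rule refl_onI)
    fix p :: parabolic_pair assume "p \<in> P_zhat_closure \<times> P_plus_real"
    then obtain a b c d where "p = (par_matrix a b, par_matrix c d)" "c > 0"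
      by (auto simp: P_zhat_closure_def P_plus_real_def)
    then show "(p, p) \<in> parabolic_rel"
      unfolding \<open>p = _\<close> parabolic_rel_alt by (metis add.right_neutral of_int_0)
  qed
  show "sym parabolic_rel"
  proof (rule symI)
    fix p q :: parabolic_pair assume "(p, q) \<in> parabolic_rel"
    then obtain a b c d n where *: "p = (par_matrix a b, par_matrix c d)" "c > 0"
      "q = (par_matrix a (b + of_int n), par_matrix c (d + of_int n))"
      by (cases p; cases q) (auto simp: parabolic_rel_alt)
    show "(q, p) \<in> parabolic_rel"
      unfolding * parabolic_rel_alt
      by (rule exI[of _ a], rule exI[of _ "b + of_int n"], rule exI[of _ c],
          rule exI[of _ "d + of_int n"], rule exI[of _ "- n"]) (simp add: *)
  qed
  show "trans parabolic_rel"
  proof (rule transI)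
    fix p q r :: parabolic_pair assume "(p, q) \<in> parabolic_rel" and qr: "(q, r) \<in> parabolic_rel"
    then obtain a b c d n where *: "p = (par_matrix a b, par_matrix c d)" "c > 0"
      "q = (par_matrix a (b + of_int n), par_matrix c (d + of_int n))"
      by (cases p; cases q) (auto simp: parabolic_rel_alt)
    from qr obtain a' b' c' d' m where **: "q = (par_matrix a' b', par_matrix c' d')"
      "r = (par_matrix a' (b' + of_int m), par_matrix c' (d' + of_int m))"
      by (cases q; cases r) (auto simp: parabolic_rel_alt)
    have r: "r = (par_matrix a (b + of_int n + of_int m), par_matrix c (d + of_int n + of_int m))"
      using * ** by (simp add: par_matrix_eq_iff)
    show "(p, r) \<in> parabolic_rel"
      unfolding r \<open>p = _\<close> parabolic_rel_alt
      by (rule exI[of _ a], rule exI[of _ b], rule exI[of _ c],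
          rule exI[of _ d], rule exI[of _ "n + m"]) (simp add: * algebra_simps)
  qed
qed

lemma parabolic_class_eq:
  assumes "c > 0"
  shows "parabolic_rel `` {(par_matrix a b, par_matrix c d)} =
           range (\<lambda>n. (par_matrix a (b + of_int n), par_matrix c (d + of_int n)))"
  using assms by (auto simp: parabolic_rel_alt par_matrix_eq_iff image_iff)

lemma parabolic_act_in_parabolic_space:
  assumes X: "X \<in> parabolic_space" and w: "w \<in> P_zhat"
  shows "parabolic_act X w \<in> parabolic_space"
proof -
  obtain u v where w: "w = par_matrix u v" using w by (auto simp: P_zhat_def)
  obtain a b c d where c: "c > 0" and X: "X = parabolic_rel `` {(par_matrix a b, par_matrix c d)}"
    using X by (auto simp: parabolic_space_def quotient_def P_zhat_closure_def P_plus_real_def)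
  have "parabolic_act X w = parabolic_rel `` {(par_matrix a b ** w, par_matrix c d)}"
    unfolding parabolic_act_def X w par_matrix_mult parabolic_class_eq[OF c] image_image
    by (simp add: par_matrix_mult add.assoc)
  then show ?thesis
    using c unfolding parabolic_space_def w par_matrix_mult
    by (auto simp: P_zhat_closure_def P_plus_real_def par_matrix_eq_iff intro!: quotientI)
qed

abbreviation base1 :: complex where "base1 \<equiv> 1"
abbreviation base2 :: complex where "base2 \<equiv> - \<i>"

text \<open>\<open>Re z\<close> and \<open>- Im z\<close> are the coordinates of \<open>z\<close> in the basis \<open>base1, base2\<close>.\<close>

definition matrix_act :: "real^2^2 \<Rightarrow> complex \<Rightarrow> complex"
  where "matrix_act M z =
           (let c = M *v vector [Re z, - Im z] in of_real (c $ 1) * base1 + of_real (c $ 2) * base2)"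

definition std_lattice :: "complex set"
  where "std_lattice = {of_int m * base1 + of_int n * base2 | m n. True}"

text \<open>The coset \<open>x base1 + y base2\<close> of \<open>std_lattice\<close>.\<close>

definition std_torsion_point :: "rat_mod_int \<Rightarrow> rat_mod_int \<Rightarrow> complex set"
  where "std_torsion_point x y =
           {of_rat r * base1 + of_rat s * base2 | r s. rat_class r = x \<and> rat_class s = y}"

definition rho_map :: "zhat^2^2 \<Rightarrow> rat_mod_int \<times> rat_mod_int \<Rightarrow> complex set"
  where "rho_map \<rho> = (\<lambda>(x, y).
           std_torsion_point (zhat_apply (\<rho> $ 1 $ 1) x + zhat_apply (\<rho> $ 1 $ 2) y) y)"

definition qlattice_pair ::
    "parabolic_pair \<Rightarrow> complex set \<times> (rat_mod_int \<times> rat_mod_int \<Rightarrow> complex set)"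
  where "qlattice_pair = (\<lambda>(\<rho>, \<alpha>).
           (matrix_act (matrix_inv \<alpha>) ` std_lattice,
            \<lambda>p. matrix_act (matrix_inv \<alpha>) ` rho_map \<rho> p))"

lemma matrix_act_par_matrix:
  "matrix_act (par_matrix a b) z = Complex (a * Re z - b * Im z) (Im z)"
  by (simp add: matrix_act_def Let_def matrix_vector_mult_def par_matrix_def sum_2 complex_eq_iff)

lemma matrix_inv_par_matrix:
  assumes "c \<noteq> 0"
  shows "matrix_inv (par_matrix c d) = (par_matrix (1 / c) (- d / c) :: real^2^2)" (is "_ = ?B")
proof -
  let ?A = "par_matrix c d"
  have "(mat 1 :: real^2^2) = par_matrix 1 0"
    by (simp add: mat_def par_matrix_def vec_eq_iff forall_2)
  then have inv: "?A ** ?B = mat 1 \<and> ?B ** ?A = mat 1"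
    using assms by (simp add: par_matrix_mult)
  have "?A ** matrix_inv ?A = mat 1 \<and> matrix_inv ?A ** ?A = mat 1"
    unfolding matrix_inv_def by (rule someI[where x = ?B]) (rule inv)
  then have *: "matrix_inv ?A ** ?A = mat 1" by (rule conjunct2)
  have "matrix_inv ?A = matrix_inv ?A ** (?A ** ?B)"
    by (simp only: inv matrix_mul_rid)
  also have "\<dots> = ?B"
    by (simp only: matrix_mul_assoc * matrix_mul_lid)
  finally show ?thesis .
qed

lemma zhat_apply_of_int: "zhat_apply (of_int n) (rat_class s) = rat_class (of_int n * s)"
proof (induction n rule: int_induct[where k = 0])
  case base
  show ?case by (simp add: zero_zhat.rep_eq zero_rat_mod_int_def)
next
  case (step1 i)
  then show ?case
    by (simp add: plus_zhat.rep_eq one_zhat.rep_eq plus_rat_mod_int.abs_eq distrib_right)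
next
  case (step2 i)
  then show ?case
    by (simp add: minus_zhat.rep_eq one_zhat.rep_eq minus_rat_mod_int.abs_eq left_diff_distrib)
qed

lemma matrix_act_shift_inverse:
  "matrix_act (par_matrix 1 (of_int (- n))) (matrix_act (par_matrix 1 (of_int n)) z) = z"
  by (simp add: matrix_act_par_matrix)

lemma shift_std_lattice: "matrix_act (par_matrix 1 (of_int n)) ` std_lattice = std_lattice"
proof -
  have sub: "matrix_act (par_matrix 1 (of_int k)) z \<in> std_lattice" if z: "z \<in> std_lattice" for k :: int and z
  proof -
    obtain p q where z: "z = of_int p * base1 + of_int q * base2" using z by (auto simp: std_lattice_def)
    have "matrix_act (par_matrix 1 (of_int k)) z = of_int (p + k * q) * base1 + of_int q * base2"
      by (simp add: z matrix_act_par_matrix complex_eq_iff)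
    then show ?thesis unfolding std_lattice_def by blast
  qed
  show ?thesis
  proof (intro equalityI subsetI)
    fix z assume "z \<in> std_lattice"
    then have "matrix_act (par_matrix 1 (of_int (- n))) z \<in> std_lattice" by (rule sub)
    then show "z \<in> matrix_act (par_matrix 1 (of_int n)) ` std_lattice"
      using matrix_act_shift_inverse[of "- n" z] by (metis imageI minus_minus)
  qed (use sub in auto)
qed

lemma shift_std_torsion_point:
  "matrix_act (par_matrix 1 (of_int n)) ` std_torsion_point x y =
     std_torsion_point (x + zhat_apply (of_int n) y) y"
proof -
  have sub: "matrix_act (par_matrix 1 (of_int k)) z \<in> std_torsion_point (x + zhat_apply (of_int k) y) y"
    if z: "z \<in> std_torsion_point x y" for k :: int and x y z
  proof -
    obtain r s where z: "z = of_rat r * base1 + of_rat s * base2" and rs: "rat_class r = x" "rat_class s = y"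
      using z by (auto simp: std_torsion_point_def)
    have of_rat: "Re (of_rat q) = of_rat q" "Im (of_rat q) = 0" for q
      by (cases q; simp add: of_rat_rat)+
    have 1: "matrix_act (par_matrix 1 (of_int k)) z = of_rat (r + of_int k * s) * base1 + of_rat s * base2"
      by (simp add: z matrix_act_par_matrix complex_eq_iff of_rat of_rat_add of_rat_mult)
    have "rat_class (r + of_int k * s) = x + zhat_apply (of_int k) y"
      by (simp add: rs[symmetric] zhat_apply_of_int plus_rat_mod_int.abs_eq)
    with 1 rs(2) show ?thesis unfolding std_torsion_point_def by blast
  qed
  show ?thesis
  proof (intro equalityI subsetI)
    fix z assume "z \<in> std_torsion_point (x + zhat_apply (of_int n) y) y"
    then have "matrix_act (par_matrix 1 (of_int (- n))) z
                 \<in> std_torsion_point (x + zhat_apply (of_int n) y + zhat_apply (of_int (- n)) y) y"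
      by (rule sub)
    then have "matrix_act (par_matrix 1 (of_int (- n))) z \<in> std_torsion_point x y"
      by (simp add: uminus_zhat.rep_eq)
    then show "z \<in> matrix_act (par_matrix 1 (of_int n)) ` std_torsion_point x y"
      using matrix_act_shift_inverse[of "- n" z] by (metis imageI minus_minus)
  qed (use sub in auto)
qed

lemma qlattice_pair_shift:
  assumes c: "c > 0"
  shows "qlattice_pair (par_matrix a (b + of_int n), par_matrix c (d + of_int n)) =
         qlattice_pair (par_matrix a b, par_matrix c d)"
proof -
  have act: "matrix_act (matrix_inv (par_matrix c d)) z =
             matrix_act (matrix_inv (par_matrix c (d + of_int n)))
               (matrix_act (par_matrix 1 (of_int n)) z)" for z
    using c by (simp add: matrix_inv_par_matrix matrix_act_par_matrix field_simps)
  have img: "matrix_act (matrix_inv (par_matrix c d)) ` S =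
             matrix_act (matrix_inv (par_matrix c (d + of_int n))) `
               (matrix_act (par_matrix 1 (of_int n)) ` S)" for S
    by (simp only: image_image act[symmetric])
  have rho: "rho_map (par_matrix a (b + of_int n)) p =
             matrix_act (par_matrix 1 (of_int n)) ` rho_map (par_matrix a b) p" for p
    by (cases p) (simp add: rho_map_def par_matrix_def shift_std_torsion_point[unfolded par_matrix_def]
          plus_zhat.rep_eq add.assoc)
  show ?thesis
    by (simp only: qlattice_pair_def prod.case img shift_std_lattice rho)
qed

text \<open>\<open>qlattice_pair\<close> is constant on each class in \<open>parabolic_space\<close>; see \<open>qlattice_class\<close>.\<close>

definition qlattice ::
    "parabolic_pair set \<Rightarrow> complex set \<times> (rat_mod_int \<times> rat_mod_int \<Rightarrow> complex set)"
  where "qlattice X = the_elem (qlattice_pair ` X)"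

lemma qlattice_class:
  assumes "c > 0"
  shows "qlattice (parabolic_rel `` {(par_matrix a b, par_matrix c d)}) =
         qlattice_pair (par_matrix a b, par_matrix c d)"
  by (simp add: qlattice_def parabolic_class_eq[OF assms] image_image qlattice_pair_shift[OF assms])

definition qlattice_triple ::
    "parabolic_pair set \<Rightarrow>
     complex set \<times> (rat_mod_int \<Rightarrow> complex set) \<times> (rat_mod_int \<Rightarrow> complex set)"
  where "qlattice_triple X =
           (let (\<Lambda>, \<phi>) = qlattice X in (\<Lambda>, \<lambda>x. \<phi> (x, 0), \<lambda>y. \<phi> (0, y)))"

text \<open>
  Every triangular elliptic curve is isomorphic to the triple of exactly one parabolic
  \<open>\<rat>\<close>-lattice. The definition only expresses that \<open>X\<close> is such a lattice, not its uniqueness.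
\<close>

definition associated ::
    "parabolic_pair set \<Rightarrow>
     complex set \<Rightarrow> (rat_mod_int \<Rightarrow> complex set) \<Rightarrow> (rat_mod_int \<Rightarrow> complex set) \<Rightarrow> bool"
  where "associated X \<Lambda> \<xi> \<eta> \<longleftrightarrow>
           X \<in> parabolic_space \<and> triple_iso (qlattice_triple X) (\<Lambda>, \<xi>, \<eta>)"

end

theory Submission
  imports Defs
begin

text \<open>
  Writing \<open>\<langle>\<psi>, \<xi>\<rangle>\<close> for \<open>tate_map \<psi> \<xi>\<close>, the pairing of characters with the Tate module is additive in
  \<open>\<xi>\<close> and satisfies \<open>\<langle>\<psi>, \<xi> \<circ> u\<rangle> = \<langle>\<psi>, \<xi>\<rangle> u\<close> (\<open>tate_map_mult\<close>, \<open>tate_map_comp_zhat\<close>). Since \<open>u\<close> is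
  a unit, \<open>\<xi> \<circ> u\<close> is non-zero and has the same orthogonal as \<open>\<xi>\<close>. For \<open>\<psi>\<close> in this orthogonal,
  \<open>\<langle>\<psi>, \<eta> + \<xi> \<circ> v\<rangle> = \<langle>\<psi>, \<eta>\<rangle> + \<langle>\<psi>, \<xi>\<rangle> v = \<langle>\<psi>, \<eta>\<rangle>\<close>, so the set of values that has to be \<open>\<int>\<close> does not
  change either. This shows that the new triple is triangular (\<open>triangular_act\<close>).

  For the parabolic lattice, the action multiplies \<open>\<rho>\<close> by \<open>w\<close> on the right and leaves \<open>\<alpha>\<close>, hence the
  lattice, unchanged. As \<open>w (x, 0) = (u x, 0)\<close> and \<open>w (0, y) = (v y, 0) + (0, y)\<close>, the labelling
  \<open>\<phi> \<circ> w\<close> yields exactly the components \<open>\<xi> \<circ> u\<close> and \<open>\<eta> + \<xi> \<circ> v\<close> of the triple that \<open>\<phi>\<close> yields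
  (\<open>qlattice_triple_act\<close>). An isomorphism of curves is additive, so the one that identifies the
  triple of \<open>X\<close> with \<open>(\<Lambda>, \<xi>, \<eta>)\<close> also identifies the two transformed triples (\<open>associated_act\<close>).

  The substance behind the first part is that \<open>\<langle>\<psi>, \<xi>\<rangle>\<close> exists at all: \<open>\<psi> \<circ> \<xi>\<close> is an additive map
  from the torsion group \<open>\<rat>/\<int>\<close> to \<open>\<real>/\<int>\<close>, so its values are torsion and lie in \<open>\<rat>/\<int>\<close>
  (\<open>additive_factors_through_zhat\<close>).
\<close>

section \<open>Cosets of subgroups of the complex numbers\<close>

lemma comm_group_additive_group: "comm_group (additive_group :: 'a::ab_group_add monoid)"
proof (rule comm_groupI)
  fix x :: 'a
  show "\<exists>y\<in>carrier additive_group. y \<otimes>\<^bsub>additive_group\<^esub> x = \<one>\<^bsub>additive_group\<^esub>"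
    by (rule bexI[of _ "- x"]) (simp_all add: additive_group_def)
qed (auto simp: additive_group_def add_ac)

lemma subgroup_additive_groupI:
  fixes H :: "'a::ab_group_add set"
  assumes "0 \<in> H" and "\<And>x y. x \<in> H \<Longrightarrow> y \<in> H \<Longrightarrow> x - y \<in> H"
  shows "subgroup H additive_group"
proof -
  interpret comm_group "additive_group :: 'a monoid" by (rule comm_group_additive_group)
  have inv: "inv\<^bsub>additive_group\<^esub> x = - x" for x :: 'a
    by (rule inv_equality) (simp_all add: additive_group_def)
  have minus: "- x \<in> H" if "x \<in> H" for x
    using assms(2)[OF assms(1) that] by simp
  show ?thesis
  proof (rule subgroupI)
    fix x y assume "x \<in> H" "y \<in> H"
    then show "x \<otimes>\<^bsub>additive_group\<^esub> y \<in> H"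
      using assms(2)[OF _ minus[of y], of x] by (simp add: additive_group_def)
  qed (use assms minus inv in \<open>auto simp: additive_group_def\<close>)
qed

lemma lattice_subgroup:
  assumes "is_lattice \<Lambda>"
  shows "subgroup \<Lambda> additive_group"
proof -
  obtain w1 w2 where L: "\<Lambda> = {of_int m * w1 + of_int n * w2 | m n. True}"
    using assms by (auto simp: is_lattice_def)
  show ?thesis
  proof (rule subgroup_additive_groupI)
    have "0 = of_int 0 * w1 + of_int 0 * w2" by simp
    then show "0 \<in> \<Lambda>" unfolding L by blast
  next
    fix x y assume "x \<in> \<Lambda>" "y \<in> \<Lambda>"
    then obtain m n m' n' where "x = of_int m * w1 + of_int n * w2" "y = of_int m' * w1 + of_int n' * w2"
      unfolding L by blast
    then have "x - y = of_int (m - m') * w1 + of_int (n - n') * w2"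
      by (simp add: algebra_simps)
    then show "x - y \<in> \<Lambda>" unfolding L by blast
  qed
qed

text \<open>
  Closure under subtraction is not visible from the definition by multiples of single lattice
  vectors; putting two rational coefficients over a common denominator shows that the set is the
  rational span of a basis of \<open>\<Lambda>\<close>.
\<close>

lemma rational_multiples_subgroup:
  assumes "is_lattice \<Lambda>"
  shows "subgroup (rational_multiples \<Lambda>) additive_group"
proof -
  obtain w1 w2 where L: "\<Lambda> = {of_int m * w1 + of_int n * w2 | m n. True}"
    using assms by (auto simp: is_lattice_def)
  have span: "rational_multiples \<Lambda> = {of_rat p * w1 + of_rat q * w2 | p q. True}"
  proof (intro equalityI subsetI)
    fix z assume "z \<in> rational_multiples \<Lambda>"
    then obtain q m n where "z = of_rat q * (of_int m * w1 + of_int n * w2)"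
      unfolding rational_multiples_def L by blast
    then have "z = of_rat (q * of_int m) * w1 + of_rat (q * of_int n) * w2"
      by (simp add: of_rat_mult algebra_simps)
    then show "z \<in> {of_rat p * w1 + of_rat q * w2 | p q. True}" by blast
  next
    fix z assume "z \<in> {of_rat p * w1 + of_rat q * w2 | p q. True}"
    then obtain p q where z: "z = of_rat p * w1 + of_rat q * w2" by blast
    obtain a b where p: "p = of_int a / of_int b" "b > 0"
      by (metis quotient_of_denom_pos quotient_of_div surj_pair)
    obtain c d where q: "q = of_int c / of_int d" "d > 0"
      by (metis quotient_of_denom_pos quotient_of_div surj_pair)
    have pq: "p = 1 / of_int (b * d) * of_int (a * d)" "q = 1 / of_int (b * d) * of_int (c * b)"
      using p q by (simp_all add: field_simps)
    have "of_rat p = of_rat (1 / of_int (b * d)) * (of_int (a * d) :: complex)"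
      "of_rat q = of_rat (1 / of_int (b * d)) * (of_int (c * b) :: complex)"
      by (simp_all only: pq of_rat_mult of_rat_of_int_eq)
    then have "z = of_rat (1 / of_int (b * d)) * (of_int (a * d) * w1 + of_int (c * b) * w2)"
      by (simp only: z distrib_left mult.assoc)
    then show "z \<in> rational_multiples \<Lambda>" unfolding rational_multiples_def L by blast
  qed
  show ?thesis
  proof (rule subgroup_additive_groupI)
    have "0 = of_rat 0 * w1 + of_rat 0 * w2" by simp
    then show "0 \<in> rational_multiples \<Lambda>" unfolding span by blast
  next
    fix x y assume "x \<in> rational_multiples \<Lambda>" "y \<in> rational_multiples \<Lambda>"
    then obtain m n m' n' where "x = of_rat m * w1 + of_rat n * w2" "y = of_rat m' * w1 + of_rat n' * w2"
      unfolding span by blast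
    then have "x - y = of_rat (m - m') * w1 + of_rat (n - n') * w2"
      by (simp add: algebra_simps of_rat_diff)
    then show "x - y \<in> rational_multiples \<Lambda>" unfolding span by blast
  qed
qed

lemma comm_group_torsion_group:
  assumes "is_lattice \<Lambda>"
  shows "comm_group (torsion_group \<Lambda>)"
proof -
  interpret C: comm_group "additive_group :: complex monoid" by (rule comm_group_additive_group)
  let ?Q = "additive_group\<lparr>carrier := rational_multiples \<Lambda>\<rparr>"
  interpret Q: comm_group ?Q
    by (rule group.group_comm_groupI[OF C.subgroup_imp_group[OF rational_multiples_subgroup[OF assms]]])
      (simp add: additive_group_def add.commute)
  have "l \<in> rational_multiples \<Lambda>" if "l \<in> \<Lambda>" for l
    using that unfolding rational_multiples_def by (metis (mono_tags, lifting) mem_Collect_eq mult_1 of_rat_1)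
  then have "subgroup \<Lambda> ?Q"
    by (intro C.subgroup_incl lattice_subgroup rational_multiples_subgroup assms) auto
  then show ?thesis
    unfolding torsion_group_def by (rule Q.abelian_FactGroup)
qed

text \<open>
  Both operations are addition of subsets of \<open>\<complex>\<close>; this allows one to pass between \<open>E\<close>, the domain of
  characters and isomorphisms, and \<open>E\<^sub>t\<^sub>o\<^sub>r\<close>, the target of Tate module elements. The two lattices may
  differ because the sum of two subsets does not involve the lattice.
\<close>

lemma torsion_group_mult_eq:
  "A \<otimes>\<^bsub>torsion_group \<Lambda>\<^esub> B = A \<otimes>\<^bsub>elliptic_curve \<Lambda>'\<^esub> B"
  by (simp add: torsion_group_def elliptic_curve_def FactGroup_def set_mult_def)

lemma torsion_group_carrier_subset: "carrier (torsion_group \<Lambda>) \<subseteq> carrier (elliptic_curve \<Lambda>)"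
  by (auto simp: torsion_group_def elliptic_curve_def FactGroup_def RCOSETS_def r_coset_def
      additive_group_def)

section \<open>Characters evaluated on the Tate module\<close>

lemma real_of_rat_mod_int_add:
  "real_of_rat_mod_int (x + y) = real_of_rat_mod_int x + real_of_rat_mod_int y"
  by transfer (simp add: of_rat_add)

lemma real_of_rat_mod_int_inj: "inj real_of_rat_mod_int"
proof (rule injI)
  fix x y assume "real_of_rat_mod_int x = real_of_rat_mod_int y"
  then show "x = y"
  proof transfer
    fix x y :: rat assume "of_rat x - of_rat y \<in> (\<int> :: real set)"
    then obtain k where "of_rat x - of_rat y = (of_int k :: real)" by (rule Ints_cases)
    then have "of_rat (x - y) = (of_rat (of_int k) :: real)" by (simp add: of_rat_diff)
    then show "x - y \<in> \<int>" by (simp only: of_rat_eq_iff) simp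
  qed
qed

text \<open>
  If \<open>n q\<close> is an integer and \<open>r\<close> represents the image of \<open>q\<close>, then \<open>n r\<close> represents the image of \<open>0\<close>
  and is an integer, so that \<open>r\<close> is rational.
\<close>

lemma additive_range_real_of_rat_mod_int:
  fixes h :: "rat_mod_int \<Rightarrow> real_mod_int"
  assumes h: "\<And>x y. h (x + y) = h x + h y"
  shows "h x \<in> range real_of_rat_mod_int"
proof -
  obtain q where x: "x = rat_class q" by (rule rat_class_surj)
  obtain r where r: "h x = real_class r"
    by (metis Quotient_real_mod_int Quotient_abs_rep)
  obtain a b where ab: "quotient_of q = (a, b)" by fastforce
  define n where "n = nat b"
  have b: "b > 0" using quotient_of_denom_pos[OF ab] .
  then have n: "of_nat n = (of_int b :: rat)" "n > 0" by (simp_all add: n_def)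
  have h0: "h 0 = 0" using h[of 0 0] by simp
  have mult: "h (rat_class (of_nat m * q)) = real_class (of_nat m * r)" for m :: nat
  proof (induction m)
    case 0
    show ?case using h0 by (simp add: zero_rat_mod_int_def zero_real_mod_int_def)
  next
    case (Suc m)
    have "rat_class (of_nat (Suc m) * q) = rat_class (of_nat m * q) + rat_class q"
      by (simp add: plus_rat_mod_int.abs_eq algebra_simps)
    then show ?case
      using Suc r x by (simp add: h plus_real_mod_int.abs_eq algebra_simps)
  qed
  have "of_nat n * q = of_int a"
    using b n(1) quotient_of_div[OF ab] by simp
  then have "rat_class (of_nat n * q) = 0" by (simp add: rat_class_eq_0_iff)
  then have "real_class (of_nat n * r) = real_class 0"
    using mult[of n] h0 by (simp add: zero_real_mod_int_def)
  then have "of_nat n * r \<in> \<int>"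
    by (simp add: real_mod_int.abs_eq_iff)
  then obtain k where "of_nat n * r = of_int k" by (rule Ints_cases)
  then have "r = of_int k / of_nat n" using n(2) by (simp add: field_simps)
  then have "r = of_rat (of_int k / of_nat n)" by (simp add: of_rat_divide)
  then have "h x = real_of_rat_mod_int (rat_class (of_int k / of_nat n))"
    by (simp add: r real_of_rat_mod_int.abs_eq)
  then show ?thesis by blast
qed

lemma additive_factors_through_zhat:
  fixes h :: "rat_mod_int \<Rightarrow> real_mod_int"
  assumes h: "\<And>x y. h (x + y) = h x + h y"
  obtains f where "\<And>x. real_of_rat_mod_int (zhat_apply f x) = h x"
proof -
  define g where "g = inv_into UNIV real_of_rat_mod_int \<circ> h"
  have g: "real_of_rat_mod_int (g x) = h x" for x
    by (simp add: g_def f_inv_into_f[OF additive_range_real_of_rat_mod_int[OF h]])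
  have "g (x + y) = g x + g y" for x y
    by (rule injD[OF real_of_rat_mod_int_inj]) (simp add: g h real_of_rat_mod_int_add)
  then have "zhat_apply (Abs_zhat g) = g" by (intro Abs_zhat_inverse) simp
  with g that show thesis by metis
qed

lemma tate_map_unique:
  assumes "\<And>x. real_of_rat_mod_int (zhat_apply f x) = \<psi> (\<xi> x)"
  shows "tate_map \<psi> \<xi> = f"
  unfolding tate_map_def
proof (rule the_equality)
  fix g assume "\<forall>x. real_of_rat_mod_int (zhat_apply g x) = \<psi> (\<xi> x)"
  then have "zhat_apply g x = zhat_apply f x" for x
    using assms injD[OF real_of_rat_mod_int_inj] by metis
  then show "g = f" by (metis ext zhat_apply_inject)
qed (use assms in blast)

lemma tate_module_in_carrier:
  assumes "\<xi> \<in> tate_module \<Lambda>"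
  shows "\<xi> x \<in> carrier (torsion_group \<Lambda>)" "\<xi> x \<in> carrier (elliptic_curve \<Lambda>)"
  using assms torsion_group_carrier_subset
  by (auto simp: tate_module_def hom_def additive_group_def)

lemma tate_module_add:
  assumes "\<xi> \<in> tate_module \<Lambda>"
  shows "\<xi> (x + y) = \<xi> x \<otimes>\<^bsub>torsion_group \<Lambda>\<^esub> \<xi> y"
  using assms by (auto simp: tate_module_def hom_def additive_group_def)

lemma character_mult:
  assumes "\<psi> \<in> characters \<Lambda>" "A \<in> carrier (elliptic_curve \<Lambda>)" "B \<in> carrier (elliptic_curve \<Lambda>)"
  shows "\<psi> (A \<otimes>\<^bsub>torsion_group \<Lambda>\<^esub> B) = \<psi> A + \<psi> B"
  using assms unfolding torsion_group_mult_eq[where \<Lambda>' = \<Lambda>]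
  by (auto simp: characters_def hom_def additive_group_def)

text \<open>
  The description by \<open>THE\<close> is meaningful: an endomorphism exists because \<open>\<psi> \<circ> \<xi>\<close> is additive, and
  it is unique because \<open>\<rat>/\<int>\<close> embeds into \<open>\<real>/\<int>\<close>.
\<close>

lemma tate_map_apply:
  assumes \<psi>: "\<psi> \<in> characters \<Lambda>" and \<xi>: "\<xi> \<in> tate_module \<Lambda>"
  shows "real_of_rat_mod_int (zhat_apply (tate_map \<psi> \<xi>) x) = \<psi> (\<xi> x)"
proof -
  have "\<psi> (\<xi> (x + y)) = \<psi> (\<xi> x) + \<psi> (\<xi> y)" for x y
    by (simp add: tate_module_add[OF \<xi>] character_mult[OF \<psi>] tate_module_in_carrier[OF \<xi>])
  then obtain f where f: "real_of_rat_mod_int (zhat_apply f x) = \<psi> (\<xi> x)" for x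
    using additive_factors_through_zhat[of "\<lambda>x. \<psi> (\<xi> x)"] by blast
  then show ?thesis using tate_map_unique[of f \<psi> \<xi>] by simp
qed

lemma tate_map_comp_zhat:
  assumes "\<psi> \<in> characters \<Lambda>" and "\<xi> \<in> tate_module \<Lambda>"
  shows "tate_map \<psi> (\<xi> \<circ> zhat_apply u) = tate_map \<psi> \<xi> * u"
  by (rule tate_map_unique) (simp add: times_zhat.rep_eq tate_map_apply[OF assms])

lemma tate_map_mult:
  assumes \<psi>: "\<psi> \<in> characters \<Lambda>" and \<xi>: "\<xi> \<in> tate_module \<Lambda>" and \<eta>: "\<eta> \<in> tate_module \<Lambda>"
  shows "tate_map \<psi> (\<lambda>y. \<eta> y \<otimes>\<^bsub>torsion_group \<Lambda>\<^esub> \<xi> y) = tate_map \<psi> \<eta> + tate_map \<psi> \<xi>"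
  by (rule tate_map_unique)
    (simp add: plus_zhat.rep_eq real_of_rat_mod_int_add tate_map_apply[OF \<psi>] \<xi> \<eta>
      character_mult[OF \<psi>] tate_module_in_carrier[OF \<xi>] tate_module_in_carrier[OF \<eta>])

lemma tate_module_comp_zhat:
  assumes "\<xi> \<in> tate_module \<Lambda>"
  shows "\<xi> \<circ> zhat_apply u \<in> tate_module \<Lambda>"
  using assms by (auto simp: tate_module_def hom_def additive_group_def zhat_apply_add)

lemma tate_module_mult:
  assumes L: "is_lattice \<Lambda>" and \<xi>: "\<xi> \<in> tate_module \<Lambda>" and \<eta>: "\<eta> \<in> tate_module \<Lambda>"
  shows "(\<lambda>y. \<eta> y \<otimes>\<^bsub>torsion_group \<Lambda>\<^esub> \<xi> y) \<in> tate_module \<Lambda>"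
proof -
  interpret comm_group "torsion_group \<Lambda>" by (rule comm_group_torsion_group[OF L])
  show ?thesis
    unfolding tate_module_def hom_def
    by (auto simp: additive_group_def tate_module_add[OF \<xi>] tate_module_add[OF \<eta>] m_ac
        tate_module_in_carrier[OF \<xi>] tate_module_in_carrier[OF \<eta>])
qed

section \<open>Triangularity of the transformed triple\<close>

lemma triangular_act:
  assumes tri: "triangular \<Lambda> \<xi> \<eta>" and u: "u dvd 1"
  shows "triangular \<Lambda> (\<xi> \<circ> zhat_apply u)
           (\<lambda>y. \<eta> y \<otimes>\<^bsub>torsion_group \<Lambda>\<^esub> (\<xi> \<circ> zhat_apply v) y)"
    (is "triangular \<Lambda> ?\<xi> ?\<eta>")
proof -
  have L: "is_lattice \<Lambda>" and \<xi>: "\<xi> \<in> tate_module \<Lambda>" and \<eta>: "\<eta> \<in> tate_module \<Lambda>"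
    and ne: "\<xi> \<noteq> (\<lambda>_. \<one>\<^bsub>torsion_group \<Lambda>\<^esub>)"
    and ints: "{tate_map \<psi> \<eta> | \<psi>. \<psi> \<in> orth \<Lambda> \<xi>} = \<int>"
    using tri by (auto simp: triangular_def)
  obtain u' where u': "u * u' = 1" using u by (metis dvdE)
  have "?\<xi> \<noteq> (\<lambda>_. \<one>\<^bsub>torsion_group \<Lambda>\<^esub>)"
  proof
    assume *: "?\<xi> = (\<lambda>_. \<one>\<^bsub>torsion_group \<Lambda>\<^esub>)"
    have "\<xi> x = \<one>\<^bsub>torsion_group \<Lambda>\<^esub>" for x
    proof -
      have "zhat_apply u (zhat_apply u' x) = x"
        by (metis u' times_zhat.rep_eq one_zhat.rep_eq)
      then show ?thesis using fun_cong[OF *, of "zhat_apply u' x"] by simp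
    qed
    with ne show False by blast
  qed
  moreover have orth: "orth \<Lambda> ?\<xi> = orth \<Lambda> \<xi>"
  proof -
    have "t * u = 0 \<longleftrightarrow> t = 0" for t
      by (metis u' mult.assoc mult_1_right mult_zero_left)
    then have "tate_map \<psi> ?\<xi> = 0 \<longleftrightarrow> tate_map \<psi> \<xi> = 0" if "\<psi> \<in> characters \<Lambda>" for \<psi>
      unfolding tate_map_comp_zhat[OF that \<xi>] .
    then show ?thesis unfolding orth_def by blast
  qed
  moreover have "tate_map \<psi> ?\<eta> = tate_map \<psi> \<eta>" if "\<psi> \<in> orth \<Lambda> \<xi>" for \<psi>
  proof -
    have \<psi>: "\<psi> \<in> characters \<Lambda>" and 0: "tate_map \<psi> \<xi> = 0"
      using that by (auto simp: orth_def)
    show ?thesis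
      unfolding tate_map_mult[OF \<psi> tate_module_comp_zhat[OF \<xi>] \<eta>] tate_map_comp_zhat[OF \<psi> \<xi>] 0
      by simp
  qed
  then have "{tate_map \<psi> ?\<eta> | \<psi>. \<psi> \<in> orth \<Lambda> \<xi>} = {tate_map \<psi> \<eta> | \<psi>. \<psi> \<in> orth \<Lambda> \<xi>}"
    by (intro Collect_cong) metis
  ultimately show ?thesis
    unfolding triangular_def ints orth
    using L tate_module_comp_zhat[OF \<xi>] tate_module_mult[OF L tate_module_comp_zhat[OF \<xi>] \<eta>] ints by simp
qed

section \<open>Torsion points of a parabolic lattice\<close>

lemma matrix_act_add: "matrix_act M (z + z') = matrix_act M z + matrix_act M z'"
  by (simp add: matrix_act_def Let_def matrix_vector_mult_def sum_2 complex_eq_iff algebra_simps)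

lemma elliptic_curve_mult: "A \<otimes>\<^bsub>elliptic_curve \<Lambda>\<^esub> B = {a + b | a b. a \<in> A \<and> b \<in> B}"
  by (auto simp: elliptic_curve_def FactGroup_def set_mult_def additive_group_def)

lemma elliptic_curve_carrier: "carrier (elliptic_curve \<Lambda>) = range (\<lambda>z. (\<lambda>l. l + z) ` \<Lambda>)"
  by (auto simp: elliptic_curve_def FactGroup_def RCOSETS_def r_coset_def additive_group_def)

lemma matrix_act_image_mult:
  "matrix_act M ` (A \<otimes>\<^bsub>elliptic_curve \<Lambda>\<^esub> B) =
     matrix_act M ` A \<otimes>\<^bsub>elliptic_curve \<Lambda>'\<^esub> matrix_act M ` B"
  unfolding elliptic_curve_mult by (auto simp: image_iff) (metis matrix_act_add)+

lemma matrix_act_image_carrier: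
  assumes "A \<in> carrier (elliptic_curve \<Lambda>)"
  shows "matrix_act M ` A \<in> carrier (elliptic_curve (matrix_act M ` \<Lambda>))"
  using assms by (auto simp: elliptic_curve_carrier image_image matrix_act_add)

text \<open>
  Any two pairs of representatives differ by integers, hence the points with given classes form a
  single coset. So torsion points are elements of the curve, where an isomorphism is known to be
  additive.
\<close>

lemma std_torsion_point_rat_class:
  "std_torsion_point (rat_class r) (rat_class s) =
     (\<lambda>l. l + (of_rat r * base1 + of_rat s * base2)) ` std_lattice"
proof (intro equalityI subsetI)
  fix z assume "z \<in> std_torsion_point (rat_class r) (rat_class s)"
  then obtain r' s' where z: "z = of_rat r' * base1 + of_rat s' * base2"
    and "r' - r \<in> \<int>" "s' - s \<in> \<int>"
    by (auto simp: std_torsion_point_def rat_mod_int.abs_eq_iff)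
  then obtain m n where "r' = r + of_int m" "s' = s + of_int n"
    by (metis Ints_cases add_diff_cancel_left' add.commute diff_add_cancel)
  then have "z = (of_int m * base1 + of_int n * base2) + (of_rat r * base1 + of_rat s * base2)"
    by (simp add: z of_rat_add algebra_simps)
  then show "z \<in> (\<lambda>l. l + (of_rat r * base1 + of_rat s * base2)) ` std_lattice"
    unfolding std_lattice_def by blast
next
  fix z assume "z \<in> (\<lambda>l. l + (of_rat r * base1 + of_rat s * base2)) ` std_lattice"
  then obtain m n where "z = (of_int m * base1 + of_int n * base2) + (of_rat r * base1 + of_rat s * base2)"
    unfolding std_lattice_def by blast
  then have "z = of_rat (of_int m + r) * base1 + of_rat (of_int n + s) * base2"
    by (simp add: of_rat_add algebra_simps)
  moreover have "rat_class (of_int m + r) = rat_class r" "rat_class (of_int n + s) = rat_class s"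
    by (simp_all add: rat_mod_int.abs_eq_iff)
  ultimately show "z \<in> std_torsion_point (rat_class r) (rat_class s)"
    unfolding std_torsion_point_def by blast
qed

lemma std_torsion_point_carrier: "std_torsion_point x y \<in> carrier (elliptic_curve std_lattice)"
proof -
  obtain r s where "x = rat_class r" "y = rat_class s" by (metis rat_class_surj)
  then show ?thesis by (simp add: std_torsion_point_rat_class elliptic_curve_carrier)
qed

lemma std_torsion_point_add:
  "std_torsion_point (x + x') (y + y') =
     std_torsion_point x y \<otimes>\<^bsub>elliptic_curve \<Lambda>\<^esub> std_torsion_point x' y'"
proof (intro equalityI subsetI)
  fix z assume "z \<in> std_torsion_point (x + x') (y + y')"
  then obtain r s where z: "z = of_rat r * base1 + of_rat s * base2"
    and rs: "rat_class r = x + x'" "rat_class s = y + y'"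
    by (auto simp: std_torsion_point_def)
  obtain p q where pq: "x = rat_class p" "y = rat_class q" by (metis rat_class_surj)
  have "z = (of_rat p * base1 + of_rat q * base2) + (of_rat (r - p) * base1 + of_rat (s - q) * base2)"
    by (simp add: z of_rat_diff algebra_simps)
  moreover have "rat_class (r - p) = x'" "rat_class (s - q) = y'"
    using rs by (simp_all add: pq minus_rat_mod_int.abs_eq[symmetric])
  ultimately show "z \<in> std_torsion_point x y \<otimes>\<^bsub>elliptic_curve \<Lambda>\<^esub> std_torsion_point x' y'"
    unfolding elliptic_curve_mult std_torsion_point_def using pq by blast
next
  fix z assume "z \<in> std_torsion_point x y \<otimes>\<^bsub>elliptic_curve \<Lambda>\<^esub> std_torsion_point x' y'"
  then obtain p q p' q' where z: "z = (of_rat p * base1 + of_rat q * base2) + (of_rat p' * base1 + of_rat q' * base2)"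
    and "rat_class p = x" "rat_class q = y" "rat_class p' = x'" "rat_class q' = y'"
    unfolding elliptic_curve_mult std_torsion_point_def by blast
  then have "rat_class (p + p') = x + x'" "rat_class (q + q') = y + y'"
    by (simp_all add: plus_rat_mod_int.abs_eq[symmetric])
  moreover have "z = of_rat (p + p') * base1 + of_rat (q + q') * base2"
    by (simp add: z of_rat_add algebra_simps)
  ultimately show "z \<in> std_torsion_point (x + x') (y + y')"
    unfolding std_torsion_point_def by blast
qed

lemma rho_map_par_matrix:
  "rho_map (par_matrix a b) (x, y) = std_torsion_point (zhat_apply a x + zhat_apply b y) y"
  by (simp add: rho_map_def par_matrix_def)

lemma zhat_apply_0: "zhat_apply f 0 = 0"
  using zhat_apply_add[of f 0 0] by simp

text \<open>
  Since \<open>w (x, y) = (u x + v y, y)\<close> and \<open>\<rho>\<close> is additive, the point splits along the two coordinates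
  into a value of \<open>\<eta>\<close> and a value of \<open>\<xi>\<close>. This is the source of the term \<open>\<xi> \<circ> v\<close>.
\<close>

lemma rho_map_act:
  "rho_map (par_matrix a b ** par_matrix u v) (x, y) =
     rho_map (par_matrix a b) (0, y) \<otimes>\<^bsub>elliptic_curve \<Lambda>\<^esub>
     rho_map (par_matrix a b) (zhat_apply u x + zhat_apply v y, 0)"
  unfolding par_matrix_mult rho_map_par_matrix std_torsion_point_add[symmetric]
  by (simp add: zhat_apply_0 zhat_apply_add times_zhat.rep_eq plus_zhat.rep_eq add_ac)

section \<open>The right action on parabolic lattices\<close>

text \<open>
  The relation comes from multiplication by integral matrices on the left, which commutes with
  multiplication by \<open>w\<close> on the right.
\<close>

lemma parabolic_act_class:
  assumes "c > 0"
  shows "parabolic_act (parabolic_rel `` {(par_matrix a b, par_matrix c d)}) (par_matrix u v) =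
           parabolic_rel `` {(par_matrix a b ** par_matrix u v, par_matrix c d)}"
  unfolding parabolic_act_def par_matrix_mult parabolic_class_eq[OF assms] image_image
  by (simp add: par_matrix_mult add.assoc)

lemma qlattice_triple_act:
  assumes X: "X \<in> parabolic_space" and T: "qlattice_triple X = (M, \<xi>, \<eta>)"
  shows "qlattice_triple (parabolic_act X (par_matrix u v)) =
           (M, \<xi> \<circ> zhat_apply u, \<lambda>y. \<eta> y \<otimes>\<^bsub>elliptic_curve M\<^esub> \<xi> (zhat_apply v y))"
    and "\<xi> x \<in> carrier (elliptic_curve M)" and "\<eta> x \<in> carrier (elliptic_curve M)"
proof -
  obtain a b c d where c: "c > 0" and X: "X = parabolic_rel `` {(par_matrix a b, par_matrix c d)}"
    using X by (auto simp: parabolic_space_def quotient_def P_zhat_closure_def P_plus_real_def)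
  let ?A = "matrix_inv (par_matrix c d)"
  let ?\<rho> = "par_matrix a b"
  have M: "M = matrix_act ?A ` std_lattice"
    and \<xi>: "\<xi> = (\<lambda>x. matrix_act ?A ` rho_map ?\<rho> (x, 0))"
    and \<eta>: "\<eta> = (\<lambda>y. matrix_act ?A ` rho_map ?\<rho> (0, y))"
    using T unfolding X qlattice_triple_def qlattice_class[OF c] qlattice_pair_def by auto
  show "\<xi> x \<in> carrier (elliptic_curve M)" "\<eta> x \<in> carrier (elliptic_curve M)"
    unfolding \<xi> \<eta> M rho_map_par_matrix
    by (intro matrix_act_image_carrier std_torsion_point_carrier)+
  have "rho_map (?\<rho> ** par_matrix u v) (x, 0) = rho_map ?\<rho> (zhat_apply u x, 0)" for x
    by (simp add: par_matrix_mult rho_map_par_matrix times_zhat.rep_eq zhat_apply_0)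
  moreover have "rho_map (?\<rho> ** par_matrix u v) (0, y) =
      rho_map ?\<rho> (0, y) \<otimes>\<^bsub>elliptic_curve std_lattice\<^esub> rho_map ?\<rho> (zhat_apply v y, 0)" for y
    by (simp add: rho_map_act[where \<Lambda> = std_lattice] zhat_apply_0)
  ultimately show "qlattice_triple (parabolic_act X (par_matrix u v)) =
           (M, \<xi> \<circ> zhat_apply u, \<lambda>y. \<eta> y \<otimes>\<^bsub>elliptic_curve M\<^esub> \<xi> (zhat_apply v y))"
    unfolding X parabolic_act_class[OF c] qlattice_triple_def par_matrix_mult qlattice_class[OF c]
    by (simp add: par_matrix_mult[symmetric] qlattice_pair_def M[symmetric] \<xi> \<eta> o_def
        matrix_act_image_mult[where \<Lambda>' = M])
qed

text \<open>
  The isomorphism of curves that belongs to \<open>X\<close> also works for the image of \<open>X\<close>: both have the same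
  lattice, and the isomorphism carries the new points along because it respects sums.
\<close>

lemma associated_act:
  assumes assoc: "associated X \<Lambda> \<xi> \<eta>" and w: "par_matrix u v \<in> P_zhat"
  shows "associated (parabolic_act X (par_matrix u v)) \<Lambda> (\<xi> \<circ> zhat_apply u)
           (\<lambda>y. \<eta> y \<otimes>\<^bsub>torsion_group \<Lambda>\<^esub> (\<xi> \<circ> zhat_apply v) y)"
proof -
  obtain M \<xi>0 \<eta>0 where T: "qlattice_triple X = (M, \<xi>0, \<eta>0)" by (metis surj_pair)
  have X: "X \<in> parabolic_space" and "triple_iso (M, \<xi>0, \<eta>0) (\<Lambda>, \<xi>, \<eta>)"
    using assoc unfolding associated_def T by auto
  then obtain f where f: "curve_iso M \<Lambda> f" and \<xi>: "\<And>x. f (\<xi>0 x) = \<xi> x" and \<eta>: "\<And>y. f (\<eta>0 y) = \<eta> y"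
    by (auto simp: triple_iso_def)
  have "f \<in> hom (elliptic_curve M) (elliptic_curve \<Lambda>)"
    using f by (simp add: curve_iso_def iso_def)
  then have "f (\<eta>0 y \<otimes>\<^bsub>elliptic_curve M\<^esub> \<xi>0 z) = \<eta> y \<otimes>\<^bsub>torsion_group \<Lambda>\<^esub> \<xi> z" for y z
    by (simp add: hom_mult qlattice_triple_act(2,3)[OF X T] \<xi> \<eta> torsion_group_mult_eq[where \<Lambda>' = \<Lambda>])
  then have "triple_iso (qlattice_triple (parabolic_act X (par_matrix u v)))
      (\<Lambda>, \<xi> \<circ> zhat_apply u, \<lambda>y. \<eta> y \<otimes>\<^bsub>torsion_group \<Lambda>\<^esub> (\<xi> \<circ> zhat_apply v) y)"
    unfolding qlattice_triple_act(1)[OF X T] triple_iso_def using f \<xi> by auto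
  then show ?thesis
    using parabolic_act_in_parabolic_space[OF X w] by (simp add: associated_def)
qed

theorem proposition6p5:
  fixes \<Lambda> :: "complex set"
    and \<xi> \<eta> \<xi>' \<eta>' :: "rat_mod_int \<Rightarrow> complex set"
    and X :: "parabolic_pair set"
    and u v :: zhat
    and w :: "zhat^2^2"
  assumes "triangular \<Lambda> \<xi> \<eta>"
    and "associated X \<Lambda> \<xi> \<eta>"
    and "w = par_matrix u v" and "w \<in> P_zhat"
    and "\<xi>' = \<xi> \<circ> zhat_apply u"
    and "\<eta>' = (\<lambda>y. \<eta> y \<otimes>\<^bsub>torsion_group \<Lambda>\<^esub> (\<xi> \<circ> zhat_apply v) y)"
  shows "triangular \<Lambda> \<xi>' \<eta>' \<and> associated (parabolic_act X w) \<Lambda> \<xi>' \<eta>'"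
proof
  have "u dvd 1"
    using assms(3,4) by (auto simp: P_zhat_def par_matrix_eq_iff)
  then show "triangular \<Lambda> \<xi>' \<eta>'"
    unfolding assms(5,6) by (rule triangular_act[OF assms(1)])
  show "associated (parabolic_act X w) \<Lambda> \<xi>' \<eta>'"
    using associated_act[OF assms(2)] assms(4) unfolding assms(3,5,6) by blast
qed

end
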